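(* Let $A=[a_1~\cdots~a_n]\in\mathbb{N}^{1\times n}$ be such that $0<a_1\le\cdots\le a_n$. If three entries $a_i,a_j,a_k$ of $A$ (with $i,j,k$ distinct) are pairwise coprime, then there exists a polynomial $P\in\mathbb{R}[x_i,x_j,x_k]$ such that $P(T_{a_i}(t),T_{a_j}(t),T_{a_k}(t))=t$. Hence, the curve $\mathcal{X}_{A,T}\subset\mathbb{C}^n$ is smooth, and its prime (vanishing) ideal is $$I(\mathcal{X}_{A,T})=\langle\, x_1-T_{a_1}(P(x_i,x_j,x_k)),\ \ldots,\ x_n-T_{a_n}(P(x_i,x_j,x_k))\,\rangle\subset\mathbb{C}[x_1,\ldots,x_n].$$
   Context: The Chebyshev polynomials of the first kind are defined by $T_0(t)=1$, $T_1(t)=t$, $T_{k+1}(t)=2t\,T_k(t)-T_{k-1}(t)$. For $A=[a_1~\cdots~a_n]\in\mathbb{N}^{1\times n}$, $\mathcal{X}_{A,T}\subset\mathbb{C}^n$ denotes the Zariski closure of the image of the map $\mathbb{C}\to\mathbb{C}^n$, $t\mapsto (T_{a_1}(t),\ldots,T_{a_n}(t))$; $x_1,\ldots,x_n$ are coordinates on $\mathbb{C}^n$. *)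

theory Defs
  imports
    "HOL-Analysis.Analysis"
    "HOL-Library.Poly_Mapping"
    "HOL-Library.Extended_Nat"
    "HOL-Computational_Algebra.Polynomial"
    "HOL-Algebra.Ideal"
    "HOL-Algebra.Algebraic_Closure_Type"
begin

unbundle no fps_syntax

fun cheb :: "nat \<Rightarrow> 'a::comm_ring_1 poly" where
  "cheb 0 = 1"
| "cheb (Suc 0) = [:0, 1:]"
| "cheb (Suc (Suc k)) = [:0, 2:] * cheb (Suc k) - cheb k"

section \<open>Multivariate polynomials\<close>

text \<open>
  The polynomial ring in the variables \<open>x\<^sub>l\<close>, where \<open>l\<close> ranges over \<open>'n\<close>: a polynomial maps each
  exponent vector to its coefficient. The convolution product of \<open>Poly_Mapping\<close> makes this
  type a commutative ring.
\<close>

type_synonym ('n, 'a) mpoly = "('n \<Rightarrow>\<^sub>0 nat) \<Rightarrow>\<^sub>0 'a"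

definition mvar :: "'n \<Rightarrow> ('n, 'a::zero_neq_one) mpoly" where
  "mvar l = Poly_Mapping.single (Poly_Mapping.single l 1) 1"

definition mvars :: "('n, 'a::zero) mpoly \<Rightarrow> 'n set" where
  "mvars p = (\<Union>m \<in> Poly_Mapping.keys p. Poly_Mapping.keys m)"

text \<open>Substitution of \<open>f l\<close> for \<open>x\<^sub>l\<close>, with coefficients mapped into the target ring by \<open>c\<close>.\<close>

definition msubst ::
  "('a::zero \<Rightarrow> 'b::comm_ring_1) \<Rightarrow> ('n \<Rightarrow> 'b) \<Rightarrow> ('n, 'a) mpoly \<Rightarrow> 'b" where
  "msubst c f p = (\<Sum>m \<in> Poly_Mapping.keys p.
     c (Poly_Mapping.lookup p m) * (\<Prod>l \<in> Poly_Mapping.keys m. f l ^ Poly_Mapping.lookup m l))"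

abbreviation meval :: "('n, complex) mpoly \<Rightarrow> complex ^ 'n \<Rightarrow> complex" where
  "meval p x \<equiv> msubst (\<lambda>c. c) (\<lambda>l. x $ l) p"

text \<open>
  The formal partial derivative. The subtraction of exponents truncates only in terms with
  coefficient \<open>0\<close>.
\<close>

definition mpderiv :: "'n \<Rightarrow> ('n, 'a::comm_ring_1) mpoly \<Rightarrow> ('n, 'a) mpoly" where
  "mpderiv l p = (\<Sum>m \<in> Poly_Mapping.keys p.
     Poly_Mapping.single (m - Poly_Mapping.single l 1)
       (of_nat (Poly_Mapping.lookup m l) * Poly_Mapping.lookup p m))"

section \<open>Affine varieties\<close>

definition zero_locus :: "('n, complex) mpoly set \<Rightarrow> (complex ^ 'n) set" where
  "zero_locus F = {x. \<forall>f\<in>F. meval f x = 0}"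

definition zariski_closed :: "(complex ^ 'n) set \<Rightarrow> bool" where
  "zariski_closed Z \<longleftrightarrow> (\<exists>F. Z = zero_locus F)"

definition vanishing_ideal :: "(complex ^ 'n) set \<Rightarrow> ('n, complex) mpoly set" where
  "vanishing_ideal V = {f. \<forall>x\<in>V. meval f x = 0}"

definition irreducible_closed :: "(complex ^ 'n) set \<Rightarrow> bool" where
  "irreducible_closed Z \<longleftrightarrow> zariski_closed Z \<and> Z \<noteq> {} \<and>
     (\<forall>Z1 Z2. zariski_closed Z1 \<and> zariski_closed Z2 \<and> Z = Z1 \<union> Z2 \<longrightarrow> Z = Z1 \<or> Z = Z2)"

definition irreducible_chain :: "(complex ^ 'n) set \<Rightarrow> nat \<Rightarrow> (nat \<Rightarrow> (complex ^ 'n) set) \<Rightarrow> bool" where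
  "irreducible_chain V d Z \<longleftrightarrow>
     (\<forall>r\<le>d. irreducible_closed (Z r) \<and> Z r \<subseteq> V) \<and> (\<forall>r<d. Z r \<subset> Z (Suc r))"

text \<open>
  Krull dimension. The dimension at \<open>p\<close> only uses chains of irreducible closed sets through \<open>p\<close>;
  these correspond to the chains of prime ideals of the local ring at \<open>p\<close>.
\<close>

definition variety_dim :: "(complex ^ 'n) set \<Rightarrow> enat" where
  "variety_dim V = Sup {enat d | d. \<exists>Z. irreducible_chain V d Z}"

definition variety_dim_at :: "(complex ^ 'n) set \<Rightarrow> complex ^ 'n \<Rightarrow> enat" where
  "variety_dim_at V p = Sup {enat d | d. \<exists>Z. irreducible_chain V d Z \<and> p \<in> Z 0}"

definition tangent_space :: "(complex ^ 'n) set \<Rightarrow> complex ^ 'n \<Rightarrow> (complex ^ 'n) set" where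
  "tangent_space V p =
     {v. \<forall>f \<in> vanishing_ideal V. (\<Sum>l\<in>UNIV. meval (mpderiv l f) p * v $ l) = 0}"

text \<open>
  Smoothness at every point: the Zariski tangent space has the dimension of the variety there;
  \<open>vec.dim\<close> is the dimension over the complex numbers.
\<close>

definition smooth_variety :: "(complex ^ 'n) set \<Rightarrow> bool" where
  "smooth_variety V \<longleftrightarrow> (\<forall>p\<in>V. enat (vec.dim (tangent_space V p)) = variety_dim_at V p)"

section \<open>The Chebyshev curve\<close>

definition cheb_curve :: "('n \<Rightarrow> nat) \<Rightarrow> (complex ^ 'n) set" where
  "cheb_curve a = zariski_closed hull (range (\<lambda>t::complex. \<chi> l. poly (cheb (a l)) t))"

end

theory Submission
  imports Defs
begin

text \<open>
  Everything follows from the polynomial \<open>P\<close>. Once the parameter \<open>t\<close> is a polynomial function of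
  the point \<open>(T\<^bsub>a\<^sub>l\<^esub>(t))\<^sub>l\<close>, the parametrization is an isomorphism from the affine line onto its image.
  The image is the zero set of the polynomials \<open>x\<^sub>l - T\<^bsub>a\<^sub>l\<^esub>(P)\<close>, since their vanishing says that
  \<open>x\<close> is the point with parameter \<open>P(x)\<close>; so it is closed. Its ideal is the kernel of the pullback to
  the polynomials in \<open>t\<close>, hence prime, and modulo the same polynomials every \<open>f\<close> is congruent to the
  pullback of \<open>f\<close> evaluated at \<open>P\<close>, so that they generate the ideal. Proper closed subsets of the
  image are finite, which gives dimension one everywhere. Finally the chain rule shows that the
  tangent spaces are spanned by the velocity vectors, which are nonzero since \<open>P\<close> inverts the
  parametrization. The locale \<open>embedded_line\<close> contains this argument for arbitrary polynomials in
  place of the Chebyshev polynomials.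

  To find \<open>P\<close>, write \<open>a, b, c\<close> for the three pairwise coprime entries and \<open>S\<^sub>n\<close> for the polynomial with
  \<open>S\<^sub>n(cos x) = sin (n x) / sin x\<close>. The lemma \<open>conductor_mem\<close> shows that every multiple of the
  polynomial \<open>S\<^sub>b(T\<^sub>a)\<close> lies in the algebra generated by \<open>T\<^sub>a\<close> and \<open>T\<^sub>b\<close>. This uses that \<open>a\<close> and \<open>b\<close> are coprime:
  each \<open>n\<close> is of the form \<open>i a + j b\<close>, and the addition theorem for the sine separates the two
  summands. By symmetry every multiple of \<open>S\<^sub>c(T\<^sub>a)\<close> lies in the algebra generated by \<open>T\<^sub>a\<close> and \<open>T\<^sub>c\<close>. Since \<open>b\<close>
  and \<open>c\<close> are coprime, \<open>S\<^sub>b\<close> and \<open>S\<^sub>c\<close> generate the unit ideal, and so do \<open>S\<^sub>b(T\<^sub>a)\<close> and \<open>S\<^sub>c(T\<^sub>a)\<close>.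
  Therefore \<open>T\<^sub>a\<close>, \<open>T\<^sub>b\<close> and \<open>T\<^sub>c\<close> together generate all polynomials (\<open>X_mem\<close>), and in particular \<open>t\<close>.
\<close>

\<comment> \<open>In this file the dollar sign selects components of vectors, not coefficients of power series.\<close>
no_notation fps_nth (infixl \<open>$\<close> 75)


section \<open>Homomorphisms of commutative rings\<close>

text \<open>
  Evaluations, coefficient embeddings and substitutions are all ring homomorphisms, and most
  identities below say that two of them agree. A locale on types serves for all of them.
\<close>

locale unital_hom =
  fixes h :: "'a::comm_ring_1 \<Rightarrow> 'b::comm_ring_1"
  assumes hom_add: "h (x + y) = h x + h y"
    and hom_mult: "h (x * y) = h x * h y"
    and hom_one: "h 1 = 1"
begin

lemma hom_zero: "h 0 = 0"
  using hom_add[of 0 0] by simp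

lemma hom_diff: "h (x - y) = h x - h y"
  using hom_add[of "x - y" y] by (simp add: algebra_simps)

lemma hom_sum: "h (sum f A) = (\<Sum>x\<in>A. h (f x))"
  by (induction A rule: infinite_finite_induct) (simp_all add: hom_zero hom_add)

lemma hom_power: "h (x ^ n) = h x ^ n"
  by (induction n) (simp_all add: hom_one hom_mult)

lemma hom_prod: "h (prod f A) = (\<Prod>x\<in>A. h (f x))"
  by (induction A rule: infinite_finite_induct) (simp_all add: hom_one hom_mult)

text \<open>The coefficients of a Chebyshev polynomial are integers, so every homomorphism fixes them.\<close>

lemma map_poly_cheb: "map_poly h (cheb n) = cheb n"
proof (induction n rule: cheb.induct)
  case 1
  show ?case by (simp add: hom_one)
next
  case 2
  show ?case by (simp add: hom_one hom_zero map_poly_pCons)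
next
  case (3 k)
  have two: "h 2 = 2"
    using hom_add[of 1 1] by (simp add: hom_one)
  have diff: "map_poly h (p - q) = map_poly h p - map_poly h q" for p q
    by (rule poly_eqI) (simp add: coeff_map_poly hom_zero hom_diff)
  from 3 show ?case
    by (simp add: diff two hom_zero map_poly_smult map_poly_pCons hom_mult)
qed

lemma unital_hom_poly_map_poly: "unital_hom (\<lambda>p. poly (map_poly h p) x)"
proof
  have add: "map_poly h (p + q) = map_poly h p + map_poly h q" for p q
    by (rule poly_eqI) (simp add: coeff_map_poly hom_zero hom_add)
  then show "poly (map_poly h (p + q)) x = poly (map_poly h p) x + poly (map_poly h q) x" for p q
    by simp
  show "poly (map_poly h (p * q)) x = poly (map_poly h p) x * poly (map_poly h q) x" for p q
    by (induction p)
       (simp_all add: add hom_zero hom_mult map_poly_smult map_poly_pCons algebra_simps)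
  show "poly (map_poly h 1) x = 1"
    by (simp add: hom_one)
qed

end

lemma unital_hom_id: "unital_hom (\<lambda>c. c)"
  by unfold_locales simp_all

lemma unital_hom_poly_const: "unital_hom (\<lambda>c. [:c:])"
  by unfold_locales (simp_all add: one_pCons)

lemma unital_hom_poly: "unital_hom (\<lambda>p. poly p x)"
  by unfold_locales simp_all

lemma unital_hom_of_real: "unital_hom complex_of_real"
  by unfold_locales simp_all

lemma unital_hom_single_0:
  "unital_hom (\<lambda>c::'a::comm_ring_1. Poly_Mapping.single (0::'n \<Rightarrow>\<^sub>0 nat) c)"
  by unfold_locales (simp_all add: single_add mult_single)


section \<open>Substitution into polynomials in several variables\<close>

text \<open>
  Two polynomials have different supports in general. Sums over a common superset of the supports
  make their substitutions comparable term by term.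
\<close>

lemma msubst_superset:
  assumes "c 0 = 0" "finite K" "Poly_Mapping.keys p \<subseteq> K"
  shows "msubst c f p = (\<Sum>m\<in>K. c (Poly_Mapping.lookup p m) *
           (\<Prod>l \<in> Poly_Mapping.keys m. f l ^ Poly_Mapping.lookup m l))"
  unfolding msubst_def using assms
  by (intro sum.mono_neutral_left) (auto simp: in_keys_iff)

lemma msubst_map:
  assumes "c 0 = 0" "g 0 = 0"
  shows "msubst c f (Poly_Mapping.map g p) = msubst (\<lambda>x. c (g x)) f p"
proof -
  have lookup: "Poly_Mapping.lookup (Poly_Mapping.map g p) m = g (Poly_Mapping.lookup p m)" for m
    using assms(2) by (simp add: Poly_Mapping.map.rep_eq when_def)
  have "Poly_Mapping.keys (Poly_Mapping.map g p) \<subseteq> Poly_Mapping.keys p"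
    using assms(2) by (auto simp: in_keys_iff lookup)
  then have "msubst c f (Poly_Mapping.map g p) = (\<Sum>m\<in>Poly_Mapping.keys p.
      c (Poly_Mapping.lookup (Poly_Mapping.map g p) m) *
        (\<Prod>l \<in> Poly_Mapping.keys m. f l ^ Poly_Mapping.lookup m l))"
    using assms(1) by (intro msubst_superset) simp_all
  then show ?thesis
    by (simp add: msubst_def lookup)
qed

lemma prod_keys_eq_prod_UNIV:
  fixes f :: "'n::finite \<Rightarrow> 'b::comm_ring_1"
  shows "(\<Prod>l \<in> Poly_Mapping.keys m. f l ^ Poly_Mapping.lookup m l)
    = (\<Prod>l \<in> UNIV. f l ^ Poly_Mapping.lookup m l)"
  by (intro prod.mono_neutral_left) (auto simp: in_keys_iff)

lemma sum_single_lookup: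
  "p = (\<Sum>m\<in>Poly_Mapping.keys p. Poly_Mapping.single m (Poly_Mapping.lookup p m))"
  by (rule poly_mapping_eqI) (auto simp: lookup_sum lookup_single when_def in_keys_iff)

context unital_hom
begin

lemma msubst_add: "msubst h f (p + q) = msubst h f p + msubst h f q"
proof -
  let ?K = "Poly_Mapping.keys p \<union> Poly_Mapping.keys q"
  have "msubst h f (p + q) = (\<Sum>m\<in>?K. h (Poly_Mapping.lookup (p + q) m) *
          (\<Prod>l \<in> Poly_Mapping.keys m. f l ^ Poly_Mapping.lookup m l))"
    by (intro msubst_superset) (simp_all add: hom_zero keys_add)
  also have "\<dots> = (\<Sum>m\<in>?K. h (Poly_Mapping.lookup p m) *
          (\<Prod>l \<in> Poly_Mapping.keys m. f l ^ Poly_Mapping.lookup m l))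
      + (\<Sum>m\<in>?K. h (Poly_Mapping.lookup q m) *
          (\<Prod>l \<in> Poly_Mapping.keys m. f l ^ Poly_Mapping.lookup m l))"
    by (simp add: lookup_add hom_add ring_distribs sum.distrib)
  also have "\<dots> = msubst h f p + msubst h f q"
    by (intro arg_cong2[of _ _ _ _ "(+)"] msubst_superset[symmetric]) (simp_all add: hom_zero)
  finally show ?thesis .
qed

lemma msubst_sum: "msubst h f (sum p A) = (\<Sum>x\<in>A. msubst h f (p x))"
proof (induction A rule: infinite_finite_induct)
  case (insert x A)
  then show ?case by (simp add: msubst_add)
qed (simp_all add: msubst_def)

lemma msubst_single:
  "msubst h f (Poly_Mapping.single m c)
    = h c * (\<Prod>l \<in> Poly_Mapping.keys m. f l ^ Poly_Mapping.lookup m l)"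
  by (simp add: msubst_def hom_zero)

text \<open>
  Both sides are additive in each factor, so that it suffices to multiply two monomials; there it
  is the addition of exponent vectors.
\<close>

lemma msubst_mult:
  fixes f :: "'n::finite \<Rightarrow> 'b"
  shows "msubst h f (p * q) = msubst h f p * msubst h f q"
proof -
  have single: "msubst h f (Poly_Mapping.single m c * Poly_Mapping.single m' c')
      = msubst h f (Poly_Mapping.single m c) * msubst h f (Poly_Mapping.single m' c')" for m m' c c'
    unfolding mult_single msubst_single prod_keys_eq_prod_UNIV
    by (simp add: lookup_add power_add prod.distrib hom_mult algebra_simps)
  let ?s = "\<lambda>p m. Poly_Mapping.single m (Poly_Mapping.lookup p m)"
  have "msubst h f (sum (?s p) (Poly_Mapping.keys p) * sum (?s q) (Poly_Mapping.keys q))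
      = msubst h f (sum (?s p) (Poly_Mapping.keys p)) * msubst h f (sum (?s q) (Poly_Mapping.keys q))"
    by (simp add: sum_product msubst_sum single)
  then show ?thesis
    using sum_single_lookup[of p] sum_single_lookup[of q] by simp
qed

lemma unital_hom_msubst:
  fixes f :: "'n::finite \<Rightarrow> 'b"
  shows "unital_hom (msubst h f)"
proof
  show "msubst h f 1 = 1"
    using msubst_single[of f 0 1] by (simp add: hom_one)
qed (simp_all add: msubst_add msubst_mult)

lemma msubst_mvar: "msubst h f (mvar l) = f l"
  by (simp add: mvar_def msubst_single hom_one)

lemma hom_msubst: "h (msubst c f p) = msubst (\<lambda>x. h (c x)) (\<lambda>l. h (f l)) p"
  by (simp add: msubst_def hom_sum hom_mult hom_prod hom_power)

end

lemma msubst_single_0_mvar: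
  fixes p :: "('n, 'a::comm_ring_1) mpoly"
  shows "msubst (Poly_Mapping.single 0) mvar p = p"
proof -
  have pow: "mvar l ^ k = (Poly_Mapping.single (Poly_Mapping.single l k) 1 :: ('n, 'a) mpoly)"
    for l :: 'n and k
    by (induction k)
       (simp_all add: mvar_def mult_single single_add[symmetric] flip: single_one)
  have mon: "(\<Prod>l\<in>A. Poly_Mapping.single (Poly_Mapping.single l (Poly_Mapping.lookup m l)) 1)
      = (Poly_Mapping.single (\<Sum>l\<in>A. Poly_Mapping.single l (Poly_Mapping.lookup m l)) 1 ::
          ('n, 'a) mpoly)" for m :: "'n \<Rightarrow>\<^sub>0 nat" and A
    by (induction A rule: infinite_finite_induct) (simp_all add: mult_single)
  have sum_single_lookup_exponents:
    "(\<Sum>l\<in>Poly_Mapping.keys m. Poly_Mapping.single l (Poly_Mapping.lookup m l)) = m"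
    for m :: "'n \<Rightarrow>\<^sub>0 nat"
    by (rule sum_single_lookup[symmetric])
  have "msubst (Poly_Mapping.single 0) mvar p
      = (\<Sum>m\<in>Poly_Mapping.keys p. Poly_Mapping.single m (Poly_Mapping.lookup p m))"
    unfolding msubst_def pow mon sum_single_lookup_exponents by (simp add: mult_single)
  also have "\<dots> = p"
    by (rule sum_single_lookup[symmetric])
  finally show ?thesis .
qed


section \<open>Algebras generated by Chebyshev polynomials\<close>

text \<open>
  \<open>sin_multiple n\<close> is the Chebyshev polynomial of the second kind \<open>U\<^sub>n\<^sub>-\<^sub>1\<close>: its value at \<open>cos x\<close>
  is \<open>sin (n x) / sin x\<close>. The shift of the index makes it odd in \<open>n\<close>.
\<close>

fun sin_multiple :: "nat \<Rightarrow> real poly" where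
  "sin_multiple 0 = 0"
| "sin_multiple (Suc 0) = 1"
| "sin_multiple (Suc (Suc k)) = [:0, 2:] * sin_multiple (Suc k) - sin_multiple k"

text \<open>
  Bezout coefficients have arbitrary signs. With integer indices, cosine even and sine odd, the
  addition theorems need no case distinctions.
\<close>

definition chebT :: "int \<Rightarrow> real poly" where
  "chebT n = cheb (nat \<bar>n\<bar>)"

definition chebS :: "int \<Rightarrow> real poly" where
  "chebS n = (if n < 0 then - sin_multiple (nat \<bar>n\<bar>) else sin_multiple (nat \<bar>n\<bar>))"

lemma poly_cheb_cos: "poly (cheb n) (cos x) = cos (real n * x)"
proof (induction n rule: cheb.induct)
  case (3 k)
  have "cos (real (Suc (Suc k)) * x) + cos (real k * x) = 2 * cos x * cos (real (Suc k) * x)"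
    using cos_add[of "real (Suc k) * x" x] cos_diff[of "real (Suc k) * x" x]
    by (simp add: algebra_simps)
  with 3 show ?case by (simp add: algebra_simps)
qed simp_all

lemma poly_sin_multiple_cos: "poly (sin_multiple n) (cos x) * sin x = sin (real n * x)"
proof (induction n rule: sin_multiple.induct)
  case (3 k)
  have "sin (real (Suc (Suc k)) * x) + sin (real k * x) = 2 * cos x * sin (real (Suc k) * x)"
    using sin_add[of "real (Suc k) * x" x] sin_diff[of "real (Suc k) * x" x]
    by (simp add: algebra_simps)
  with 3 show ?case by (simp add: algebra_simps)
qed simp_all

lemma poly_chebT_cos: "poly (chebT n) (cos x) = cos (of_int n * x)"
  by (cases "n < 0") (simp_all add: chebT_def poly_cheb_cos)

lemma poly_chebS_cos: "poly (chebS n) (cos x) * sin x = sin (of_int n * x)"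
  by (cases "n < 0") (simp_all add: chebS_def poly_sin_multiple_cos)

text \<open>
  The numbers \<open>cos x\<close> with \<open>sin x \<noteq> 0\<close> fill an interval, which is more than the roots of a nonzero
  polynomial. Trigonometric identities thus become identities of polynomials, and \<open>sin x\<close> may be
  cancelled.
\<close>

lemma real_poly_eqI_cos:
  fixes p q :: "real poly"
  assumes "\<And>x. sin x \<noteq> 0 \<Longrightarrow> poly p (cos x) = poly q (cos x)"
  shows "p = q"
proof (rule ccontr)
  assume "p \<noteq> q"
  then have "finite {y. poly (p - q) y = 0}"
    by (intro poly_roots_finite) simp
  moreover have "{-1<..<1} \<subseteq> {y. poly (p - q) y = 0}"
  proof safe
    fix y :: real
    assume y: "y \<in> {-1<..<1}"
    then have "cos (arccos y) = y" "sin (arccos y) \<noteq> 0"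
      using sin_gt_zero[of "arccos y"] arccos_lt_bounded[of y] by auto
    then show "poly (p - q) y = 0"
      using assms[of "arccos y"] by simp
  qed
  ultimately have "finite {-1<..<1::real}"
    by (rule rev_finite_subset)
  then show False
    using infinite_Ioo[of "-1" "1::real"] by simp
qed

lemma chebS_nonzero:
  assumes "n \<noteq> 0"
  shows "chebS n \<noteq> 0"
proof
  assume "chebS n = 0"
  then have "sin (of_int n * (pi / (2 * of_int n))) = 0"
    using poly_chebS_cos[of n "pi / (2 * of_int n)"] by simp
  with assms show False by simp
qed

lemma chebS_1 [simp]: "chebS 1 = 1"
  by (simp add: chebS_def)

text \<open>This is \<open>sin (m n x) / sin x\<close>, expanded by \<open>sin (n x)\<close>.\<close>

lemma chebS_mult: "chebS (m * n) = chebS m \<circ>\<^sub>p chebT n * chebS n"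
proof (rule real_poly_eqI_cos)
  fix x :: real
  assume "sin x \<noteq> 0"
  moreover have "poly (chebS m \<circ>\<^sub>p chebT n * chebS n) (cos x) * sin x
      = poly (chebS m) (cos (of_int n * x)) * (poly (chebS n) (cos x) * sin x)"
    by (simp add: poly_pcompose poly_chebT_cos)
  then have "poly (chebS m \<circ>\<^sub>p chebT n * chebS n) (cos x) * sin x
      = poly (chebS (m * n)) (cos x) * sin x"
    by (simp add: poly_chebS_cos mult.assoc)
  ultimately show "poly (chebS (m * n)) (cos x) = poly (chebS m \<circ>\<^sub>p chebT n * chebS n) (cos x)"
    by simp
qed

text \<open>The addition theorem for \<open>sin (i a x + j b x)\<close>, divided by \<open>sin x\<close>.\<close>

lemma chebS_add:
  "chebS (i * a + j * b) = chebS i \<circ>\<^sub>p chebT a * chebS a * (chebT j \<circ>\<^sub>p chebT b)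
     + (chebT i \<circ>\<^sub>p chebT a) * (chebS j \<circ>\<^sub>p chebT b * chebS b)"
proof (rule real_poly_eqI_cos)
  fix x :: real
  assume nz: "sin x \<noteq> 0"
  have T: "poly (chebT j \<circ>\<^sub>p chebT b) (cos x) = cos (of_int (j * b) * x)" for j b
    by (simp add: poly_pcompose poly_chebT_cos mult.assoc)
  have "poly (chebS (i * a + j * b)) (cos x) * sin x
      = sin (of_int (i * a) * x + of_int (j * b) * x)"
    unfolding poly_chebS_cos by (simp add: algebra_simps)
  also have "\<dots> = poly (chebS (i * a) * (chebT j \<circ>\<^sub>p chebT b)
      + (chebT i \<circ>\<^sub>p chebT a) * chebS (j * b)) (cos x) * sin x"
    unfolding sin_add poly_chebS_cos[symmetric] by (simp add: T algebra_simps)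
  finally show "poly (chebS (i * a + j * b)) (cos x) =
     poly (chebS i \<circ>\<^sub>p chebT a * chebS a * (chebT j \<circ>\<^sub>p chebT b)
     + (chebT i \<circ>\<^sub>p chebT a) * (chebS j \<circ>\<^sub>p chebT b * chebS b)) (cos x)"
    using nz by (simp add: chebS_mult)
qed

lemma mult_X_chebS: "[:0, 2:] * chebS n = chebS (n + 1) + chebS (n - 1)"
proof (rule real_poly_eqI_cos)
  fix x :: real
  assume nz: "sin x \<noteq> 0"
  have "sin (of_int (n + 1) * x) + sin (of_int (n - 1) * x) = 2 * cos x * sin (of_int n * x)"
    using sin_add[of "of_int n * x" x] sin_diff[of "of_int n * x" x] by (simp add: algebra_simps)
  then have "poly ([:0, 2:] * chebS n) (cos x) * sin x
      = poly (chebS (n + 1) + chebS (n - 1)) (cos x) * sin x"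
    unfolding poly_chebS_cos[symmetric] by (simp add: algebra_simps)
  with nz show "poly ([:0, 2:] * chebS n) (cos x) = poly (chebS (n + 1) + chebS (n - 1)) (cos x)"
    by simp
qed

locale real_subalgebra =
  fixes B :: "real poly set"
  assumes const_mem: "[:c:] \<in> B"
    and add_mem: "p \<in> B \<Longrightarrow> q \<in> B \<Longrightarrow> p + q \<in> B"
    and mult_mem: "p \<in> B \<Longrightarrow> q \<in> B \<Longrightarrow> p * q \<in> B"
begin

text \<open>A composition \<open>p \<circ>\<^sub>p q\<close> is a linear combination of powers of \<open>q\<close>.\<close>

lemma pcompose_mem: "q \<in> B \<Longrightarrow> p \<circ>\<^sub>p q \<in> B"
  by (induction p) (simp_all add: pcompose_pCons add_mem mult_mem const_mem const_mem[of 0, simplified])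

text \<open>
  The plane curve \<open>(T\<^sub>a, T\<^sub>b)\<close> has nodes, and its coordinate ring has the conductor generated by the
  polynomial \<open>D\<close> with value \<open>sin (a b x) sin x / (sin (a x) sin (b x))\<close> at \<open>cos x\<close>. That \<open>D\<close> lies
  in the conductor is explicit: for \<open>n = i a + j b\<close> the addition theorem splits \<open>D * chebS n\<close> into
  polynomials in \<open>T\<^sub>a\<close> and \<open>T\<^sub>b\<close>, and the \<open>chebS n\<close> span all polynomials. The statement is made for
  the multiple \<open>D * chebS b\<close> of \<open>D\<close>, because this multiple is a polynomial in \<open>T\<^sub>a\<close>.
\<close>

lemma conductor_mem:
  assumes ab: "coprime a b" "a \<noteq> 0" "b \<noteq> 0"
    and mem: "chebT a \<in> B" "chebT b \<in> B"
  shows "(chebS b \<circ>\<^sub>p chebT a) * g \<in> B"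
proof -
  \<comment> \<open>\<open>F i j\<close> will be \<open>D * chebS (i * a + j * b)\<close>.\<close>
  define F where "F i j = (chebS i \<circ>\<^sub>p chebT a) * (chebT j \<circ>\<^sub>p chebT b) * (chebS a \<circ>\<^sub>p chebT b)
     + (chebT i \<circ>\<^sub>p chebT a) * (chebS j \<circ>\<^sub>p chebT b) * (chebS b \<circ>\<^sub>p chebT a)" for i j
  have F_mem: "F i j \<in> B" for i j
    unfolding F_def by (intro add_mem mult_mem pcompose_mem mem)
  have nz: "chebS a * chebS b \<noteq> 0"
    using ab by (simp add: chebS_nonzero)
  have F: "chebS a * chebS b * F i j = chebS (a * b) * chebS (i * a + j * b)" for i j
  proof -
    have "chebS a * chebS b * F i j
        = chebS i \<circ>\<^sub>p chebT a * chebS a * (chebT j \<circ>\<^sub>p chebT b) * (chebS a \<circ>\<^sub>p chebT b * chebS b)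
        + (chebT i \<circ>\<^sub>p chebT a) * (chebS j \<circ>\<^sub>p chebT b * chebS b) * (chebS b \<circ>\<^sub>p chebT a * chebS a)"
      unfolding F_def by (simp only: ring_distribs mult_ac)
    also have "chebS a \<circ>\<^sub>p chebT b * chebS b = chebS (a * b)"
      by (simp add: chebS_mult)
    also have "chebS b \<circ>\<^sub>p chebT a * chebS a = chebS (a * b)"
      by (simp add: chebS_mult mult.commute[of a b])
    finally show ?thesis
      unfolding chebS_add by (simp only: ring_distribs mult_ac)
  qed
  obtain u v where uv: "u * a + v * b = 1"
    using ab(1) bezout_int[of a b] by auto
  define D where "D = F u v"
  have D: "chebS a * chebS b * D = chebS (a * b)"
    unfolding D_def F uv by simp
  have D_S: "D * chebS n = F (n * u) (n * v)" for n
  proof -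
    have "n * u * a + n * v * b = n * (u * a + v * b)"
      by (simp add: algebra_simps)
    then have "n * u * a + n * v * b = n"
      using uv by simp
    then have "chebS a * chebS b * (D * chebS n) = chebS a * chebS b * F (n * u) (n * v)"
      unfolding F by (simp add: D flip: mult.assoc)
    with nz show ?thesis
      by (simp only: mult_cancel_left) simp
  qed
  \<comment> \<open>Induction over \<open>g\<close> works for all \<open>n\<close> at once, since multiplication by the variable only
    shifts \<open>n\<close> by one in both directions.\<close>
  have D_mem: "D * g * chebS n \<in> B" for g n
  proof (induction g arbitrary: n)
    case 0
    show ?case using const_mem[of 0] by simp
  next
    case (pCons c g)
    have "pCons c g = [:c:] + [:1/2:] * [:0, 2:] * g"
      by simp
    then have "D * pCons c g * chebS n
        = [:c:] * (D * chebS n) + [:1/2:] * (D * g * ([:0, 2:] * chebS n))"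
      by (simp only: ring_distribs mult_ac)
    also have "\<dots> = [:c:] * (D * chebS n)
        + [:1/2:] * (D * g * chebS (n + 1) + D * g * chebS (n - 1))"
      unfolding mult_X_chebS by (simp only: ring_distribs)
    also have "\<dots> \<in> B"
      unfolding D_S by (intro add_mem mult_mem const_mem F_mem pCons.IH)
    finally show ?case .
  qed
  have "chebS a * (chebS b \<circ>\<^sub>p chebT a) = chebS (a * b)"
    by (simp add: chebS_mult mult.commute[of a b])
  also have "\<dots> = chebS a * (D * chebS b)"
    by (simp only: D[symmetric] mult_ac)
  finally have "chebS b \<circ>\<^sub>p chebT a = D * chebS b"
    using chebS_nonzero[OF ab(2)] mult_left_cancel by blast
  then show ?thesis
    using D_mem[of g b] by (simp only: mult_ac)
qed

text \<open>
  As \<open>b\<close> and \<open>c\<close> are coprime, \<open>chebS b\<close> and \<open>chebS c\<close> generate the unit ideal: divide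
  \<open>sin ((u b + v c) x)\<close> by \<open>sin x\<close>, where \<open>u b + v c = 1\<close>. Composed with \<open>T\<^sub>a\<close>, both generators lie in the
  conductor by the preceding lemma. Hence so does \<open>1\<close>, and the subalgebra contains the variable.
\<close>

lemma X_mem:
  assumes "coprime a b" "coprime a c" "coprime b c" "a \<noteq> 0" "b \<noteq> 0" "c \<noteq> 0"
    and mem: "chebT a \<in> B" "chebT b \<in> B" "chebT c \<in> B"
  shows "[:0, 1:] \<in> B"
proof -
  obtain u v where uv: "u * b + v * c = 1"
    using assms(3) bezout_int[of b c] by auto
  define Y where "Y = chebS u \<circ>\<^sub>p chebT b * (chebT v \<circ>\<^sub>p chebT c)"
  define Z where "Z = (chebT u \<circ>\<^sub>p chebT b) * (chebS v \<circ>\<^sub>p chebT c)"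
  have "1 = chebS b * Y + chebS c * Z"
    using chebS_add[of u b v c] unfolding uv Y_def Z_def by (simp add: mult_ac)
  then have "1 \<circ>\<^sub>p chebT a = (chebS b * Y + chebS c * Z) \<circ>\<^sub>p chebT a"
    by simp
  then have one: "1 = (chebS b \<circ>\<^sub>p chebT a) * (Y \<circ>\<^sub>p chebT a)
      + (chebS c \<circ>\<^sub>p chebT a) * (Z \<circ>\<^sub>p chebT a)"
    by (simp only: pcompose_add pcompose_mult pcompose_1)
  have "[:0, 1:] = (chebS b \<circ>\<^sub>p chebT a) * ((Y \<circ>\<^sub>p chebT a) * [:0, 1:])
      + (chebS c \<circ>\<^sub>p chebT a) * ((Z \<circ>\<^sub>p chebT a) * [:0, 1:])"
    using arg_cong[OF one, of "\<lambda>p. p * [:0, 1:]"] by (simp only: ring_distribs mult.assoc mult_1)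
  also have "\<dots> \<in> B"
    using assms by (intro add_mem conductor_mem)
  finally show ?thesis .
qed

end

lemma cheb_left_inverse:
  fixes a :: "'n::finite \<Rightarrow> nat"
  assumes "\<And>l. 0 < a l" "coprime (a i) (a j)" "coprime (a i) (a k)" "coprime (a j) (a k)"
  obtains P :: "('n, real) mpoly"
  where "mvars P \<subseteq> {i, j, k}" "msubst (\<lambda>c. [:c:]) (\<lambda>l. cheb (a l)) P = [:0, 1:]"
proof -
  interpret unital_hom "\<lambda>c::real. [:c:]"
    by (rule unital_hom_poly_const)
  let ?s = "msubst (\<lambda>c::real. [:c:]) (\<lambda>l. cheb (a l))"
  define B where "B = ?s ` {P. mvars P \<subseteq> {i, j, k}}"
  have var: "cheb (a l) \<in> B" if "l \<in> {i, j, k}" for l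
  proof -
    have "mvars (mvar l :: ('n, real) mpoly) \<subseteq> {i, j, k}"
      using that by (auto simp: mvars_def mvar_def split: if_splits)
    then show ?thesis
      unfolding B_def by (intro image_eqI[where x = "mvar l"]) (simp_all add: msubst_mvar)
  qed
  interpret real_subalgebra B
  proof
    show "[:c:] \<in> B" for c
      unfolding B_def
      by (intro image_eqI[where x = "Poly_Mapping.single 0 c"])
         (auto simp: msubst_single mvars_def)
    fix p q
    assume "p \<in> B" "q \<in> B"
    then obtain P Q where PQ: "mvars P \<subseteq> {i, j, k}" "mvars Q \<subseteq> {i, j, k}" "p = ?s P" "q = ?s Q"
      unfolding B_def by blast
    have "mvars (P + Q) \<subseteq> mvars P \<union> mvars Q"
      unfolding mvars_def using keys_add[of P Q] by blast
    with PQ show "p + q \<in> B"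
      unfolding B_def by (intro image_eqI[where x = "P + Q"]) (auto simp: msubst_add)
    have "mvars (P * Q) \<subseteq> mvars P \<union> mvars Q"
    proof
      fix l
      assume "l \<in> mvars (P * Q)"
      then obtain m m' where "m \<in> Poly_Mapping.keys P" "m' \<in> Poly_Mapping.keys Q"
        "l \<in> Poly_Mapping.keys (m + m')"
        using keys_mult[of P Q] unfolding mvars_def by blast
      then show "l \<in> mvars P \<union> mvars Q"
        using keys_add[of m m'] unfolding mvars_def by blast
    qed
    with PQ show "p * q \<in> B"
      unfolding B_def by (intro image_eqI[where x = "P * Q"]) (auto simp: msubst_mult)
  qed
  have "chebT (int (a l)) \<in> B" if "l \<in> {i, j, k}" for l
    using var[OF that] by (simp add: chebT_def)
  then have "[:0, 1:] \<in> B"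
    using assms by (intro X_mem[of "int (a i)" "int (a j)" "int (a k)"]) simp_all
  then show thesis
    unfolding B_def by (force intro: that)
qed



section \<open>Ideals of a commutative ring type\<close>

lemma ideal_ring_of_type_algebra_iff:
  fixes J :: "'a::comm_ring_1 set"
  shows "ideal J ring_of_type_algebra \<longleftrightarrow>
    0 \<in> J \<and> (\<forall>x\<in>J. \<forall>y\<in>J. x + y \<in> J) \<and> (\<forall>x\<in>J. \<forall>r. r * x \<in> J)"
proof
  assume "ideal J ring_of_type_algebra"
  then interpret ideal J "ring_of_type_algebra :: 'a ring" .
  show "0 \<in> J \<and> (\<forall>x\<in>J. \<forall>y\<in>J. x + y \<in> J) \<and> (\<forall>x\<in>J. \<forall>r. r * x \<in> J)"
    using additive_subgroup.zero_closed[OF is_additive_subgroup]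
      additive_subgroup.a_closed[OF is_additive_subgroup] I_l_closed
    unfolding ring_of_type_algebra_def by simp
next
  assume J: "0 \<in> J \<and> (\<forall>x\<in>J. \<forall>y\<in>J. x + y \<in> J) \<and> (\<forall>x\<in>J. \<forall>r. r * x \<in> J)"
  interpret R: ring "ring_of_type_algebra :: 'a ring" ..
  have minus: "\<ominus>\<^bsub>ring_of_type_algebra\<^esub> x = - x" for x :: 'a
    by (rule R.minus_equality) (simp_all add: ring_of_type_algebra_def)
  have neg: "- x \<in> J" if "x \<in> J" for x
    using J that by (metis mult_minus1)
  show "ideal J ring_of_type_algebra"
  proof (rule idealI[OF R.ring_axioms])
    show "subgroup J (add_monoid (ring_of_type_algebra :: 'a ring))"
    proof (rule R.add.subgroupI)
      show "\<ominus>\<^bsub>ring_of_type_algebra\<^esub> x \<in> J" if "x \<in> J" for x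
        using neg that by (simp add: minus)
    qed (use J in \<open>auto simp: ring_of_type_algebra_def\<close>)
  qed (use J in \<open>auto simp: ring_of_type_algebra_def mult.commute\<close>)
qed

text \<open>Congruence modulo \<open>J\<close> is compatible with sums and products.\<close>

lemma msubst_congruent_mod_ideal:
  fixes r s :: "'n \<Rightarrow> 'b::comm_ring_1"
  assumes J: "ideal J ring_of_type_algebra" and rs: "\<And>l. r l - s l \<in> J"
  shows "msubst c r f - msubst c s f \<in> J"
proof -
  have zero: "0 \<in> J"
    using J unfolding ideal_ring_of_type_algebra_iff by auto
  have add: "x + y \<in> J" and mult: "z * x \<in> J" if "x \<in> J" "y \<in> J" for x y z
    using J that unfolding ideal_ring_of_type_algebra_iff by auto
  have step: "x * x' - y * y' \<in> J" if "x - y \<in> J" "x' - y' \<in> J" for x y x' y'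
  proof -
    have "x * x' - y * y' = x * (x' - y') + y' * (x - y)"
      by (simp add: algebra_simps)
    with that show ?thesis by (simp add: add mult)
  qed
  have pow: "x ^ k - y ^ k \<in> J" if "x - y \<in> J" for x y k
    by (induction k) (simp_all add: zero step that)
  have prod: "(\<Prod>x\<in>A. u x) - (\<Prod>x\<in>A. v x) \<in> J" if "\<And>x. u x - v x \<in> J" for A :: "'n set" and u v
    by (induction A rule: infinite_finite_induct) (simp_all add: zero step that)
  have sum: "(\<Sum>x\<in>A. u x) \<in> J" if "\<And>x. u x \<in> J" for A :: "('n \<Rightarrow>\<^sub>0 nat) set" and u
    by (induction A rule: infinite_finite_induct) (simp_all add: zero add that)
  show ?thesis
    unfolding msubst_def sum_subtractf[symmetric]
    by (intro sum step prod pow rs) (simp add: zero)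
qed


section \<open>Finite Zariski closed sets\<close>

lemma zariski_closed_singleton: "zariski_closed {p :: complex ^ 'n::finite}"
proof -
  have meval: "meval (mvar l - Poly_Mapping.single 0 c) x = x $ l - c"
    for l c and x :: "complex ^ 'n"
    unfolding unital_hom.hom_diff[OF unital_hom.unital_hom_msubst[OF unital_hom_id]]
    by (simp add: unital_hom.msubst_mvar[OF unital_hom_id] unital_hom.msubst_single[OF unital_hom_id])
  have "{p} = zero_locus (range (\<lambda>l. mvar l - Poly_Mapping.single 0 (p $ l)))"
    by (auto simp: zero_locus_def meval vec_eq_iff)
  then show ?thesis
    unfolding zariski_closed_def by blast
qed

lemma irreducible_closed_singleton: "irreducible_closed {p :: complex ^ 'n::finite}"
  unfolding irreducible_closed_def
proof (intro conjI allI impI zariski_closed_singleton)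
  fix Z1 Z2
  assume "zariski_closed Z1 \<and> zariski_closed Z2 \<and> {p} = Z1 \<union> Z2"
  then show "{p} = Z1 \<or> {p} = Z2"
    by (metis singleton_Un_iff)
qed simp


lemma zariski_closed_Un:
  assumes "zariski_closed Z1" "zariski_closed (Z2 :: (complex ^ 'n::finite) set)"
  shows "zariski_closed (Z1 \<union> Z2)"
proof -
  obtain F G where FG: "Z1 = zero_locus F" "Z2 = zero_locus G"
    using assms by (auto simp: zariski_closed_def)
  have "Z1 \<union> Z2 = zero_locus {f * g | f g. f \<in> F \<and> g \<in> G}"
    unfolding FG zero_locus_def
    by (fastforce simp: unital_hom.msubst_mult[OF unital_hom_id])
  then show ?thesis
    unfolding zariski_closed_def by blast
qed

lemma zariski_closed_finite:
  fixes Z :: "(complex ^ 'n::finite) set"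
  assumes "finite Z"
  shows "zariski_closed Z"
  using assms
proof (induction Z rule: finite_induct)
  case empty
  have "{} = zero_locus {1 :: ('n, complex) mpoly}"
    by (simp add: zero_locus_def unital_hom.hom_one[OF unital_hom.unital_hom_msubst[OF unital_hom_id]])
  then show ?case
    unfolding zariski_closed_def by blast
next
  case (insert p Z)
  then show ?case
    using zariski_closed_Un[OF zariski_closed_singleton[of p]] by simp
qed

lemma finite_irreducible_closed:
  fixes Z :: "(complex ^ 'n::finite) set"
  assumes "irreducible_closed Z" "finite Z"
  obtains p where "Z = {p}"
proof -
  obtain p where p: "p \<in> Z"
    using assms(1) by (auto simp: irreducible_closed_def)
  have "zariski_closed {p}" "zariski_closed (Z - {p})" "Z = {p} \<union> (Z - {p})"
    using assms(2) p by (auto intro: zariski_closed_finite)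
  then have "Z = {p} \<or> Z = Z - {p}"
    using assms(1) unfolding irreducible_closed_def by meson
  with p that show thesis by blast
qed


section \<open>The chain rule along a curve\<close>

text \<open>
  This is the only fact about formal partial derivatives that the tangent spaces require: along
  the curve it gives tangent vectors, and along straight lines it differentiates the equations.
\<close>

lemma meval_has_field_derivative:
  fixes \<gamma> :: "complex \<Rightarrow> complex ^ 'n::finite"
  assumes "\<And>l. ((\<lambda>t. \<gamma> t $ l) has_field_derivative d l) (at s)"
  shows "((\<lambda>t. meval f (\<gamma> t)) has_field_derivative
           (\<Sum>l\<in>UNIV. meval (mpderiv l f) (\<gamma> s) * d l)) (at s)"
proof -
  interpret unital_hom "\<lambda>c::complex. c"
    by (rule unital_hom_id)
  let ?P = "\<lambda>m x. \<Prod>k\<in>UNIV. x $ k ^ Poly_Mapping.lookup m k"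
  have meval: "meval f x = (\<Sum>m\<in>Poly_Mapping.keys f. Poly_Mapping.lookup f m * ?P m x)" for x
    by (simp add: msubst_def prod_keys_eq_prod_UNIV)
  have mpderiv: "meval (mpderiv l f) x = (\<Sum>m\<in>Poly_Mapping.keys f. Poly_Mapping.lookup f m *
      (of_nat (Poly_Mapping.lookup m l) * x $ l ^ (Poly_Mapping.lookup m l - 1)
        * (\<Prod>k\<in>UNIV - {l}. x $ k ^ Poly_Mapping.lookup m k)))" for l x
  proof -
    have "?P (m - Poly_Mapping.single l 1) x = x $ l ^ (Poly_Mapping.lookup m l - 1)
        * (\<Prod>k\<in>UNIV - {l}. x $ k ^ Poly_Mapping.lookup m k)" for m
    proof -
      have "?P (m - Poly_Mapping.single l 1) x
          = x $ l ^ Poly_Mapping.lookup (m - Poly_Mapping.single l 1) l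
            * (\<Prod>k\<in>UNIV - {l}. x $ k ^ Poly_Mapping.lookup (m - Poly_Mapping.single l 1) k)"
        by (rule prod.remove) simp_all
      also have "(\<Prod>k\<in>UNIV - {l}. x $ k ^ Poly_Mapping.lookup (m - Poly_Mapping.single l 1) k)
          = (\<Prod>k\<in>UNIV - {l}. x $ k ^ Poly_Mapping.lookup m k)"
        by (rule prod.cong) (auto simp: lookup_minus lookup_single when_def)
      finally show ?thesis by (simp add: lookup_minus)
    qed
    then show ?thesis
      unfolding mpderiv_def msubst_sum msubst_single prod_keys_eq_prod_UNIV
      by (simp add: mult_ac)
  qed
  have monomial: "((\<lambda>t. ?P m (\<gamma> t)) has_field_derivative
      (\<Sum>l\<in>UNIV. of_nat (Poly_Mapping.lookup m l) * \<gamma> s $ l ^ (Poly_Mapping.lookup m l - 1)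
        * (\<Prod>k\<in>UNIV - {l}. \<gamma> s $ k ^ Poly_Mapping.lookup m k) * d l)) (at s)" for m
    by (rule DERIV_cong, rule has_field_derivative_prod)
       (auto intro!: derivative_eq_intros assms sum.cong simp: mult_ac)
  have "((\<lambda>t. meval f (\<gamma> t)) has_field_derivative
      (\<Sum>m\<in>Poly_Mapping.keys f. Poly_Mapping.lookup f m *
        (\<Sum>l\<in>UNIV. of_nat (Poly_Mapping.lookup m l) * \<gamma> s $ l ^ (Poly_Mapping.lookup m l - 1)
          * (\<Prod>k\<in>UNIV - {l}. \<gamma> s $ k ^ Poly_Mapping.lookup m k) * d l))) (at s)"
    unfolding meval by (rule DERIV_sum, rule DERIV_cmult, rule monomial)
  also have "(\<Sum>m\<in>Poly_Mapping.keys f. Poly_Mapping.lookup f m *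
        (\<Sum>l\<in>UNIV. of_nat (Poly_Mapping.lookup m l) * \<gamma> s $ l ^ (Poly_Mapping.lookup m l - 1)
          * (\<Prod>k\<in>UNIV - {l}. \<gamma> s $ k ^ Poly_Mapping.lookup m k) * d l))
      = (\<Sum>l\<in>UNIV. meval (mpderiv l f) (\<gamma> s) * d l)"
    unfolding mpderiv sum_distrib_right sum_distrib_left
    by (subst sum.swap) (simp add: mult_ac)
  finally show ?thesis .
qed


section \<open>Affine lines embedded with a polynomial left inverse\<close>

text \<open>
  A polynomial map \<open>t \<mapsto> (g\<^sub>l(t))\<^sub>l\<close> with a polynomial left inverse \<open>Q\<close> identifies the affine line
  with its image. Everything about the image follows from \<open>Q\<close>, whatever the polynomials \<open>g\<^sub>l\<close> are.
\<close>

locale embedded_line =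
  fixes g :: "'n::finite \<Rightarrow> complex poly" and Q :: "('n, complex) mpoly"
  assumes left_inverse: "msubst (\<lambda>c. [:c:]) g Q = [:0, 1:]"
begin

definition point :: "complex \<Rightarrow> complex ^ 'n" where
  "point t = (\<chi> l. poly (g l) t)"

definition pullback :: "('n, complex) mpoly \<Rightarrow> complex poly" where
  "pullback f = msubst (\<lambda>c. [:c:]) g f"

text \<open>
  Here \<open>p\<close>, a polynomial in the parameter, becomes a polynomial on the ambient space, since \<open>Q\<close>
  recovers the parameter.
\<close>

definition at_Q :: "complex poly \<Rightarrow> ('n, complex) mpoly" where
  "at_Q p = poly (map_poly (Poly_Mapping.single 0) p) Q"

lemma unital_hom_meval: "unital_hom (\<lambda>f :: ('n, complex) mpoly. meval f x)"
  by (rule unital_hom.unital_hom_msubst[OF unital_hom_id])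

lemma unital_hom_pullback: "unital_hom pullback"
  unfolding pullback_def by (rule unital_hom.unital_hom_msubst[OF unital_hom_poly_const])

lemma unital_hom_at_Q: "unital_hom at_Q"
  unfolding at_Q_def by (rule unital_hom.unital_hom_poly_map_poly[OF unital_hom_single_0])

lemma meval_point: "meval f (point t) = poly (pullback f) t"
  unfolding pullback_def unital_hom.hom_msubst[OF unital_hom_poly] by (simp add: point_def)

lemma meval_Q_point: "meval Q (point t) = t"
  unfolding meval_point pullback_def left_inverse by simp

lemma meval_at_Q: "meval (at_Q p) x = poly p (meval Q x)"
proof -
  interpret ev: unital_hom "\<lambda>f :: ('n, complex) mpoly. meval f x"
    by (rule unital_hom_meval)
  interpret id: unital_hom "\<lambda>c::complex. c"
    by (rule unital_hom_id)
  show ?thesis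
    unfolding at_Q_def
    by (induction p) (simp_all add: map_poly_pCons ev.hom_zero ev.hom_add ev.hom_mult id.msubst_single)
qed

abbreviation equation :: "'n \<Rightarrow> ('n, complex) mpoly" where
  "equation l \<equiv> mvar l - at_Q (g l)"

lemma meval_equation: "meval (equation l) x = x $ l - poly (g l) (meval Q x)"
proof -
  interpret ev: unital_hom "\<lambda>f :: ('n, complex) mpoly. meval f x"
    by (rule unital_hom_meval)
  show ?thesis
    by (simp add: ev.hom_diff meval_at_Q unital_hom.msubst_mvar[OF unital_hom_id])
qed

text \<open>If all equations hold at \<open>x\<close>, then they read \<open>x = point (Q(x))\<close>.\<close>

lemma range_point_eq_zero_locus: "range point = zero_locus (range equation)"
proof (intro equalityI subsetI)
  fix x
  assume "x \<in> range point"
  then show "x \<in> zero_locus (range equation)"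
    by (auto simp: zero_locus_def meval_equation meval_Q_point) (simp add: point_def)
next
  fix x
  assume x: "x \<in> zero_locus (range equation)"
  define t where "t = meval Q x"
  have "x $ l = poly (g l) t" for l
    using x unfolding t_def by (simp add: zero_locus_def meval_equation)
  then have "x = point t"
    by (simp add: point_def vec_eq_iff)
  then show "x \<in> range point"
    by blast
qed

lemma zariski_closed_range_point: "zariski_closed (range point)"
  unfolding zariski_closed_def using range_point_eq_zero_locus by blast

lemma vanishing_ideal_eq_kernel: "vanishing_ideal (range point) = {f. pullback f = 0}"
  by (auto simp: vanishing_ideal_def meval_point poly_all_0_iff_0)

lemma ideal_vanishing_ideal: "ideal (vanishing_ideal (range point)) ring_of_type_algebra"
proof -
  interpret unital_hom pullback
    by (rule unital_hom_pullback)
  show ?thesis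
    unfolding ideal_ring_of_type_algebra_iff vanishing_ideal_eq_kernel
    by (simp add: hom_zero hom_add hom_mult)
qed

lemma primeideal_vanishing_ideal: "primeideal (vanishing_ideal (range point)) ring_of_type_algebra"
proof -
  interpret unital_hom pullback
    by (rule unital_hom_pullback)
  show ?thesis
  proof (intro primeideal.intro primeideal_axioms.intro ideal_vanishing_ideal)
    show "cring (ring_of_type_algebra :: ('n, complex) mpoly ring)" ..
    have "1 \<notin> vanishing_ideal (range point)"
      by (simp add: vanishing_ideal_eq_kernel hom_one)
    then show "carrier ring_of_type_algebra \<noteq> vanishing_ideal (range point)"
      by (auto simp: ring_of_type_algebra_def)
  qed (simp add: ring_of_type_algebra_def vanishing_ideal_eq_kernel hom_mult)
qed

text \<open>
  Modulo the equations, each \<open>x\<^sub>l\<close> is \<open>g\<^sub>l(Q)\<close>. Hence \<open>f\<close> is congruent to \<open>at_Q (pullback f)\<close>, and this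
  is zero if \<open>f\<close> vanishes on the image.
\<close>

lemma vanishing_ideal_eq_genideal:
  "vanishing_ideal (range point) = genideal ring_of_type_algebra (range equation)"
proof -
  interpret R: ring "ring_of_type_algebra :: ('n, complex) mpoly ring" ..
  show ?thesis
  proof
    have "range equation \<subseteq> vanishing_ideal (range point)"
      using range_point_eq_zero_locus by (auto simp: vanishing_ideal_def zero_locus_def)
    then show "genideal ring_of_type_algebra (range equation) \<subseteq> vanishing_ideal (range point)"
      by (intro R.genideal_minimal ideal_vanishing_ideal)
    show "vanishing_ideal (range point) \<subseteq> genideal ring_of_type_algebra (range equation)"
    proof
      fix f
      assume "f \<in> vanishing_ideal (range point)"
      then have "at_Q (msubst (\<lambda>c. [:c:]) g f) = 0"
        unfolding vanishing_ideal_eq_kernel pullback_def[symmetric]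
        by (simp add: unital_hom.hom_zero[OF unital_hom_at_Q])
      then have "msubst (Poly_Mapping.single 0) (\<lambda>l. at_Q (g l)) f = 0"
        unfolding unital_hom.hom_msubst[OF unital_hom_at_Q] by (simp add: at_Q_def map_poly_pCons)
      moreover have "msubst (Poly_Mapping.single 0) mvar f
          - msubst (Poly_Mapping.single 0) (\<lambda>l. at_Q (g l)) f
          \<in> genideal ring_of_type_algebra (range equation)"
        by (intro msubst_congruent_mod_ideal R.genideal_ideal
              subsetD[OF R.genideal_self] rangeI)
           (simp_all add: ring_of_type_algebra_def)
      ultimately show "f \<in> genideal ring_of_type_algebra (range equation)"
        by (simp add: msubst_single_0_mvar)
    qed
  qed
qed

lemma inj_point: "inj point"
  by (metis injI meval_Q_point)

text \<open>
  A polynomial that vanishes on \<open>Z\<close> but not on the whole image pulls back to a nonzero polynomial in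
  one variable, and the parameters of the points of \<open>Z\<close> are among its finitely many roots.
\<close>

lemma finite_of_closed_psubset:
  assumes "zariski_closed Z" "Z \<subset> range point"
  shows "finite Z"
proof -
  obtain F where F: "Z = zero_locus F"
    using assms(1) by (auto simp: zariski_closed_def)
  obtain s where "point s \<notin> Z"
    using assms(2) by blast
  then obtain f where f: "f \<in> F" "poly (pullback f) s \<noteq> 0"
    unfolding F zero_locus_def by (auto simp: meval_point)
  have "Z \<subseteq> point ` {t. poly (pullback f) t = 0}"
    using assms(2) f(1) unfolding F zero_locus_def by (force simp: meval_point)
  moreover have "finite {t. poly (pullback f) t = 0}"
    using f(2) by (intro poly_roots_finite) auto
  ultimately show ?thesis
    by (rule finite_surj[rotated])
qed

lemma irreducible_closed_range_point: "irreducible_closed (range point)"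
  unfolding irreducible_closed_def
proof (intro conjI allI impI zariski_closed_range_point)
  fix Z1 Z2
  assume Z: "zariski_closed Z1 \<and> zariski_closed Z2 \<and> range point = Z1 \<union> Z2"
  have "infinite (range point)"
    using inj_point finite_imageD infinite_UNIV_char_0 by blast
  then have "infinite Z1 \<or> infinite Z2"
    using Z by auto
  then show "range point = Z1 \<or> range point = Z2"
    using Z finite_of_closed_psubset[of Z1] finite_of_closed_psubset[of Z2] by blast
qed simp

text \<open>Below the image, an irreducible closed set is finite, hence a point, and chains stop there.\<close>

lemma irreducible_chain_length:
  assumes "irreducible_chain (range point) d Z"
  shows "d \<le> 1"
proof (rule ccontr)
  assume "\<not> d \<le> 1"
  then have Z: "Z 0 \<subset> Z 1" "Z 1 \<subset> Z 2" "Z 2 \<subseteq> range point"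
    and irr: "irreducible_closed (Z 0)" "irreducible_closed (Z 1)"
    using assms by (auto simp: irreducible_chain_def numeral_2_eq_2)
  then have "finite (Z 1)"
    by (intro finite_of_closed_psubset) (auto simp: irreducible_closed_def)
  then obtain p where "Z 1 = {p}"
    using irr(2) finite_irreducible_closed by blast
  moreover have "Z 0 \<noteq> {}"
    using irr(1) by (simp add: irreducible_closed_def)
  ultimately show False
    using Z(1) by (metis psubset_imp_subset subset_singletonD psubset_eq)
qed

lemma irreducible_chain_through_point:
  "irreducible_chain (range point) 1 (\<lambda>r. if r = 0 then {point s} else range point)"
proof -
  have "point s \<noteq> point (s + 1)"
    using inj_point by (simp add: inj_eq)
  then have "point (s + 1) \<in> range point - {point s}"
    by simp
  then have "{point s} \<subset> range point"
    by (intro psubsetI) auto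
  then show ?thesis
    using irreducible_closed_singleton irreducible_closed_range_point
    by (auto simp: irreducible_chain_def)
qed

lemma variety_dim_at_range_point: "variety_dim_at (range point) (point s) = 1"
  unfolding variety_dim_at_def
proof (rule cSup_eq_maximum)
  show "1 \<in> {enat d | d. \<exists>Z. irreducible_chain (range point) d Z \<and> point s \<in> Z 0}"
    unfolding one_enat_def mem_Collect_eq
    by (intro exI conjI, rule refl, rule irreducible_chain_through_point[of s]) simp
  fix e
  assume "e \<in> {enat d | d. \<exists>Z. irreducible_chain (range point) d Z \<and> point s \<in> Z 0}"
  then show "e \<le> 1"
    using irreducible_chain_length by (auto simp only: mem_Collect_eq one_enat_def enat_ord_simps)
qed

lemma variety_dim_range_point: "variety_dim (range point) = 1"
  unfolding variety_dim_def
proof (rule cSup_eq_maximum)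
  show "1 \<in> {enat d | d. \<exists>Z. irreducible_chain (range point) d Z}"
    unfolding one_enat_def mem_Collect_eq
    by (intro exI conjI, rule refl, rule irreducible_chain_through_point[of 0])
  fix e
  assume "e \<in> {enat d | d. \<exists>Z. irreducible_chain (range point) d Z}"
  then show "e \<le> 1"
    using irreducible_chain_length by (auto simp only: mem_Collect_eq one_enat_def enat_ord_simps)
qed

definition velocity :: "complex \<Rightarrow> complex ^ 'n" where
  "velocity s = (\<chi> l. poly (pderiv (g l)) s)"

lemma sum_mpderiv_velocity:
  "(\<Sum>l\<in>UNIV. meval (mpderiv l f) (point s) * velocity s $ l) = poly (pderiv (pullback f)) s"
proof (rule DERIV_unique)
  show "((\<lambda>t. meval f (point t)) has_field_derivative
      (\<Sum>l\<in>UNIV. meval (mpderiv l f) (point s) * velocity s $ l)) (at s)"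
    by (rule meval_has_field_derivative) (simp add: point_def velocity_def poly_DERIV)
  show "((\<lambda>t. meval f (point t)) has_field_derivative poly (pderiv (pullback f)) s) (at s)"
    by (simp add: meval_point poly_DERIV)
qed

text \<open>The derivative of \<open>Q(point t) = t\<close> is \<open>1\<close>, which a vanishing velocity would contradict.\<close>

lemma velocity_nonzero: "velocity s \<noteq> 0"
proof
  assume "velocity s = 0"
  then show False
    using sum_mpderiv_velocity[where f = Q and s = s] left_inverse by (simp add: pullback_def pderiv_pCons)
qed

text \<open>
  Differentiate \<open>x\<^sub>l - g\<^sub>l(Q(x))\<close> along the line through \<open>point s\<close> with direction \<open>v\<close>.
\<close>

lemma sum_mpderiv_equation:
  "(\<Sum>m\<in>UNIV. meval (mpderiv m (equation l)) (point s) * v $ m)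
    = v $ l - (\<Sum>m\<in>UNIV. meval (mpderiv m Q) (point s) * v $ m) * velocity s $ l"
proof (rule DERIV_unique)
  let ?\<gamma> = "\<lambda>t. point s + t *s v"
  have comp: "((\<lambda>t. ?\<gamma> t $ m) has_field_derivative v $ m) (at 0)" for m
    by (auto intro!: derivative_eq_intros)
  show "((\<lambda>t. meval (equation l) (?\<gamma> t)) has_field_derivative
      (\<Sum>m\<in>UNIV. meval (mpderiv m (equation l)) (point s) * v $ m)) (at 0)"
    using meval_has_field_derivative[of ?\<gamma> "($) v" 0, OF comp] by simp
  have Q: "((\<lambda>t. meval Q (?\<gamma> t)) has_field_derivative
      (\<Sum>m\<in>UNIV. meval (mpderiv m Q) (point s) * v $ m)) (at 0)"
    using meval_has_field_derivative[of ?\<gamma> "($) v" 0, OF comp] by simp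
  have "(poly (g l) has_field_derivative velocity s $ l) (at (meval Q (?\<gamma> 0)))"
    by (simp add: meval_Q_point velocity_def poly_DERIV)
  then have "((\<lambda>t. poly (g l) (meval Q (?\<gamma> t))) has_field_derivative
      velocity s $ l * (\<Sum>m\<in>UNIV. meval (mpderiv m Q) (point s) * v $ m)) (at 0)"
    using Q by (rule DERIV_chain2)
  then have "((\<lambda>t. ?\<gamma> t $ l - poly (g l) (meval Q (?\<gamma> t))) has_field_derivative
      v $ l - velocity s $ l * (\<Sum>m\<in>UNIV. meval (mpderiv m Q) (point s) * v $ m)) (at 0)"
    by (rule DERIV_diff[OF comp])
  then show "((\<lambda>t. meval (equation l) (?\<gamma> t)) has_field_derivative
      v $ l - (\<Sum>m\<in>UNIV. meval (mpderiv m Q) (point s) * v $ m) * velocity s $ l) (at 0)"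
    unfolding meval_equation by (simp only: mult.commute)
qed

text \<open>
  The velocity is tangent because \<open>f\<close> is constant along the curve when it vanishes there.
  Conversely, the linearized equations force \<open>v = dQ(v) * velocity\<close>.
\<close>

lemma tangent_space_range_point: "tangent_space (range point) (point s) = vec.span {velocity s}"
proof (intro equalityI subsetI)
  fix v
  assume v: "v \<in> tangent_space (range point) (point s)"
  have "equation l \<in> vanishing_ideal (range point)" for l
    using range_point_eq_zero_locus by (auto simp: vanishing_ideal_def zero_locus_def)
  then have zero: "(\<Sum>m\<in>UNIV. meval (mpderiv m (equation l)) (point s) * v $ m) = 0" for l
    using v unfolding tangent_space_def by blast
  define c where "c = (\<Sum>m\<in>UNIV. meval (mpderiv m Q) (point s) * v $ m)"
  have "v $ l - c * velocity s $ l = 0" for l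
    using zero[of l] unfolding sum_mpderiv_equation c_def .
  then have "v = c *s velocity s"
    by (simp add: vec_eq_iff)
  then show "v \<in> vec.span {velocity s}"
    unfolding vec.span_singleton by blast
next
  fix v
  assume "v \<in> vec.span {velocity s}"
  then obtain c where v: "v = c *s velocity s"
    unfolding vec.span_singleton by auto
  have "(\<Sum>l\<in>UNIV. meval (mpderiv l f) (point s) * v $ l)
      = c * (\<Sum>l\<in>UNIV. meval (mpderiv l f) (point s) * velocity s $ l)" for f
    unfolding v by (simp add: sum_distrib_left mult_ac)
  then show "v \<in> tangent_space (range point) (point s)"
    unfolding tangent_space_def by (simp add: sum_mpderiv_velocity vanishing_ideal_eq_kernel)
qed

lemma smooth_range_point: "smooth_variety (range point)"
  unfolding smooth_variety_def
proof
  fix p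
  assume "p \<in> range point"
  then obtain s where "p = point s"
    by blast
  then show "enat (vec.dim (tangent_space (range point) p)) = variety_dim_at (range point) p"
    by (simp add: variety_dim_at_range_point tangent_space_range_point velocity_nonzero
          one_enat_def)
qed

end


section \<open>Smoothness and equations of the Chebyshev curve\<close>

theorem theorem3p9:
  fixes a :: "'n::{finite, linorder} \<Rightarrow> nat" and i j k :: 'n
  assumes "\<And>l. 0 < a l" and "mono a"
    and "i \<noteq> j" "i \<noteq> k" "j \<noteq> k"
    and "coprime (a i) (a j)" "coprime (a i) (a k)" "coprime (a j) (a k)"
  shows "\<exists>P :: ('n, real) mpoly. mvars P \<subseteq> {i, j, k} \<and>
           msubst (\<lambda>c. [:c:]) (\<lambda>l. cheb (a l)) P = [:0, 1:] \<and>
           variety_dim (cheb_curve a) = 1 \<and>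
           smooth_variety (cheb_curve a) \<and>
           primeideal (vanishing_ideal (cheb_curve a)) ring_of_type_algebra \<and>
           vanishing_ideal (cheb_curve a) =
             genideal ring_of_type_algebra
               (range (\<lambda>l. mvar l - poly (cheb (a l)) (Poly_Mapping.map complex_of_real P)))"
proof -
  obtain P :: "('n, real) mpoly" where P: "mvars P \<subseteq> {i, j, k}"
    "msubst (\<lambda>c. [:c:]) (\<lambda>l. cheb (a l)) P = [:0, 1:]"
    using cheb_left_inverse[of a i j k] assms(1,6-8) by blast
  let ?Q = "Poly_Mapping.map complex_of_real P"
  \<comment> \<open>The identity for \<open>P\<close> carries over to complex coefficients, because both sides of it can be
    evaluated at a complex number.\<close>
  have "msubst (\<lambda>c. [:c:]) (\<lambda>l. cheb (a l)) ?Q = [:0, 1:]"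
  proof (rule poly_eq_poly_eq_iff[THEN iffD1], rule ext)
    interpret real: unital_hom complex_of_real
      by (rule unital_hom_of_real)
    fix t :: complex
    have "poly (msubst (\<lambda>c. [:c:]) (\<lambda>l. cheb (a l)) ?Q) t
        = msubst complex_of_real (\<lambda>l. poly (cheb (a l)) t) P"
      by (simp add: unital_hom.hom_msubst[OF unital_hom_poly] msubst_map)
    also have "\<dots> = poly (map_poly complex_of_real
        (msubst (\<lambda>c. [:c:]) (\<lambda>l. cheb (a l)) P)) t"
      unfolding unital_hom.hom_msubst[OF real.unital_hom_poly_map_poly]
      by (simp add: real.map_poly_cheb map_poly_pCons)
    finally show "poly (msubst (\<lambda>c. [:c:]) (\<lambda>l. cheb (a l)) ?Q) t = poly [:0, 1:] t"
      by (simp add: P(2) map_poly_pCons)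
  qed
  then interpret embedded_line "\<lambda>l. cheb (a l)" ?Q
    by unfold_locales
  have curve: "cheb_curve a = range point"
    using zariski_closed_range_point by (simp add: cheb_curve_def point_def hull_same)
  have equation: "at_Q (cheb (a l)) = poly (cheb (a l)) ?Q" for l
    unfolding at_Q_def unital_hom.map_poly_cheb[OF unital_hom_single_0] ..
  show ?thesis
    unfolding curve
    by (intro exI[of _ P] conjI P variety_dim_range_point smooth_range_point
          primeideal_vanishing_ideal vanishing_ideal_eq_genideal[unfolded equation])
qed

end
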